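(* Let $k\ge 1$, $a_0,\dots,a_k\in\mathbb{Z}$, and let $P=\min_{0\le i\le k}\{a_i+u^{(i)}\}$ be a tropical linear differential equation of order $k$ in one unknown. (i) The set $\mathcal{C}_{\mathbb{Z}_{\ge0}}(P)$ satisfies $$\mathcal{C}_{\mathbb{Z}_{\geq0}}(P)=\begin{cases}\emptyset, & \text{if } P\notin V(A_k),\\ \{\{k+i\}: i\in\mathbb{Z}_{\ge0}\}, & \text{if } P\in V(A_k).\end{cases}$$ In particular, $P$ is holonomic if and only if $P\notin V(A_k)$. (ii) The set $F(P)$ is finite, and every element of $F(P)$ is of the form $S=t^p+t^q$ (that is, $S=\{p,q\}$) with $0\le p\le q$, where either (a) $0\le p\le q<k$, or (b) $0\le p<k\le q$, where $q=q(p)$ is unique (for each $0\le p<k$ there is at most one $q\ge k$ with $\{p,q\}\in F(P)$); case (b) occurs only when $P\notin V(A_k)$.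
   Context: For $S\subseteq\mathbb{Z}_{\ge0}$ and $i\ge 0$ put $\mathrm{val}_S(i)=\min\{s-i: s\in S,\ s\ge i\}$, and $\mathrm{val}_S(i)=\infty$ if no such $s$ exists. $S$ is a solution of $P=\min_{0\le i\le k}\{a_i+u^{(i)}\}$ if $\min_{0\le i\le k}\{a_i+\mathrm{val}_S(i)\}$ is either $\infty$ (this happens only for $S=\emptyset$) or attained for at least two values of $i$. $\mathrm{Sol}(P)$ is the set of solutions, and $\mu(\mathrm{Sol}(P))$ is the set of nonempty solutions that are minimal with respect to inclusion among nonempty solutions (the "minimal solutions"). $P$ is holonomic if $\mu(\mathrm{Sol}(P))$ is finite. The notation $t^p+t^q$ stands for the set $\{p,q\}$ (which is $\{p\}$ if $p=q$). $\mathcal{C}_{\mathbb{Z}_{\ge0}}(P)$ is the set of $S\in\mu(\mathrm{Sol}(P))$ with $\min S\ge k$, and $F(P)=\mu(\mathrm{Sol}(P))\setminus\mathcal{C}_{\mathbb{Z}_{\ge0}}(P)$. $P\in V(A_k)$ means that the minimum $A_k(P)=\min_{0\le i\le k}\{a_i+k-i\}$ is attained for at least two values of $i$. *)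

theory Defs
  imports Main "HOL-Library.Extended_Real"
begin

(* A tropical linear differential equation  min_{0 <= i <= k} {a_i + u^(i)}  of order k is given
   by k and its coefficients  a :: nat => int,  of which only a 0, ..., a k are ever used. *)

(* The infimum over the empty set is \<infinity> in enat; over a nonempty set it is attained. *)
definition val :: "nat set \<Rightarrow> nat \<Rightarrow> enat" where
  "val S i = (INF s\<in>{s \<in> S. i \<le> s}. enat (s - i))"

definition min_attained_twice :: "nat \<Rightarrow> (nat \<Rightarrow> 'b::linorder) \<Rightarrow> bool" where
  "min_attained_twice k f \<longleftrightarrow> 2 \<le> card {i \<in> {0..k}. f i = Min (f ` {0..k})}"

(* Integers with \<infinity> are embedded in the extended reals. *)
definition trop_term :: "(nat \<Rightarrow> int) \<Rightarrow> nat set \<Rightarrow> nat \<Rightarrow> ereal" where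
  "trop_term a S i = ereal (of_int (a i)) + ereal_of_enat (val S i)"

definition Sol :: "nat \<Rightarrow> (nat \<Rightarrow> int) \<Rightarrow> nat set set" where
  "Sol k a = {S. Min (trop_term a S ` {0..k}) = \<infinity> \<or> min_attained_twice k (trop_term a S)}"

definition minimal_nonempty :: "'a set set \<Rightarrow> 'a set set" where
  "minimal_nonempty X = {S \<in> X. S \<noteq> {} \<and> (\<forall>T\<in>X. T \<noteq> {} \<and> T \<subseteq> S \<longrightarrow> T = S)}"

definition holonomic :: "nat \<Rightarrow> (nat \<Rightarrow> int) \<Rightarrow> bool" where
  "holonomic k a \<longleftrightarrow> finite (minimal_nonempty (Sol k a))"

(* Minimal solutions are nonempty, so Inf S on nat is the least element of S. *)
definition C_nonneg :: "nat \<Rightarrow> (nat \<Rightarrow> int) \<Rightarrow> nat set set" where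
  "C_nonneg k a = {S \<in> minimal_nonempty (Sol k a). k \<le> Inf S}"

definition F :: "nat \<Rightarrow> (nat \<Rightarrow> int) \<Rightarrow> nat set set" where
  "F k a = minimal_nonempty (Sol k a) - C_nonneg k a"

(* P \<in> V(A_k); k - i does not truncate below as only indices i \<le> k are considered. *)
definition in_V_A :: "nat \<Rightarrow> (nat \<Rightarrow> int) \<Rightarrow> bool" where
  "in_V_A k a \<longleftrightarrow> min_attained_twice k (\<lambda>i. a i + int (k - i))"

end

theory Submission
  imports Defs
begin

text \<open>
  A nonempty set \<open>S\<close> is a solution iff two terms \<open>a i + (s - i)\<close> and \<open>a j + (t - j)\<close> with
  \<open>i \<noteq> j\<close> and \<open>s, t \<in> S\<close> are equal and minimal among all terms \<open>a l + (r - l)\<close> with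
  \<open>l \<le> k\<close>, \<open>r \<in> S\<close> and \<open>l \<le> r\<close> (lemma \<open>Sol_iff_balanced\<close>). Minimality is inherited by
  smaller sets, so every set \<open>T\<close> with \<open>{s, t} \<subseteq> T \<subseteq> S\<close> is again a solution
  (\<open>Sol_if_contains_witnesses\<close>). Hence a minimal solution is \<open>{s, t}\<close> for any such pair of witnesses.

  If \<open>s, t \<ge> k\<close>, both indices \<open>i\<close> and \<open>j\<close> may be paired with either point, so \<open>s = t\<close>.
  For a singleton \<open>{s}\<close> with \<open>s \<ge> k\<close>, the terms differ from the numbers \<open>a i + (k - i)\<close> by a
  constant, so it is a solution iff \<open>P \<in> V(A\<^sub>k)\<close>. This describes the solutions that lie
  above \<open>k\<close>. If \<open>P \<in> V(A\<^sub>k)\<close>, these singletons also prevent a solution with an element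
  below \<open>k\<close> and one above from being minimal.

  If \<open>{p, q}\<close> is a minimal solution with \<open>p < k \<le> q\<close>, its two witnesses must be \<open>p\<close> and
  \<open>q\<close>, since otherwise a singleton would do. The minimum is then both the minimum of
  \<open>a l + (p - l)\<close> over \<open>l \<le> p\<close> and the minimum of \<open>a l + (q - l)\<close> over \<open>l \<le> k\<close>. The
  former depends on \<open>p\<close> only and the latter is strictly increasing in \<open>q\<close>, so \<open>p\<close>
  determines \<open>q\<close>. Finiteness of \<open>F(P)\<close> and the criterion for holonomicity follow.
\<close>

section \<open>Solutions in terms of integer witnesses\<close>

lemma min_attained_twice_iff:
  "min_attained_twice k f \<longleftrightarrow>
    (\<exists>i\<le>k. \<exists>j\<le>k. i \<noteq> j \<and> f i = f j \<and> (\<forall>l\<le>k. f i \<le> f l))"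
proof -
  have Min_iff: "f i = Min (f ` {0..k}) \<longleftrightarrow> (\<forall>l\<le>k. f i \<le> f l)" if "i \<le> k" for i
  proof
    assume "f i = Min (f ` {0..k})"
    then show "\<forall>l\<le>k. f i \<le> f l" by simp
  next
    assume "\<forall>l\<le>k. f i \<le> f l"
    then show "f i = Min (f ` {0..k})"
      using that by (intro Min_eqI[symmetric]) auto
  qed
  have "min_attained_twice k f \<longleftrightarrow>
      (\<exists>i j. i \<noteq> j \<and> {i, j} \<subseteq> {i \<in> {0..k}. f i = Min (f ` {0..k})})"
    (is "_ \<longleftrightarrow> (\<exists>i j. i \<noteq> j \<and> {i, j} \<subseteq> ?M)")
  proof
    assume "min_attained_twice k f"
    then obtain B where "B \<subseteq> ?M" "card B = 2"
      unfolding min_attained_twice_def by (meson obtain_subset_with_card_n)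
    then show "\<exists>i j. i \<noteq> j \<and> {i, j} \<subseteq> ?M"
      by (metis card_2_iff)
  next
    assume "\<exists>i j. i \<noteq> j \<and> {i, j} \<subseteq> ?M"
    then obtain i j where "i \<noteq> j" "{i, j} \<subseteq> ?M" by blast
    moreover have "finite ?M" by simp
    ultimately have "card {i, j} \<le> card ?M" by (intro card_mono)
    with \<open>i \<noteq> j\<close> show "min_attained_twice k f"
      unfolding min_attained_twice_def by simp
  qed
  also have "\<dots> \<longleftrightarrow> (\<exists>i\<le>k. \<exists>j\<le>k. i \<noteq> j \<and> f i = f j \<and> (\<forall>l\<le>k. f i \<le> f l))"
    (is "?L \<longleftrightarrow> ?R")
  proof
    assume ?L
    then obtain i j where "i \<noteq> j" "i \<le> k" "j \<le> k"
      "f i = Min (f ` {0..k})" "f j = Min (f ` {0..k})"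
      by auto
    with Min_iff[of i] show ?R by metis
  next
    assume ?R
    then obtain i j where "i \<le> k" "j \<le> k" "i \<noteq> j" "f i = f j" "\<forall>l\<le>k. f i \<le> f l"
      by blast
    with Min_iff[of i] show ?L by (intro exI[of _ i] exI[of _ j]) auto
  qed
  finally show ?thesis .
qed

lemma trop_term_le: "s \<in> S \<Longrightarrow> l \<le> s \<Longrightarrow> trop_term a S l \<le> ereal (of_int (a l + int s - int l))"
proof -
  assume s: "s \<in> S" "l \<le> s"
  then have "val S l \<le> enat (s - l)"
    unfolding val_def by (intro INF_lower) auto
  then have "ereal_of_enat (val S l) \<le> ereal_of_enat (enat (s - l))"
    by (simp only: ereal_of_enat_le_iff)
  then have "trop_term a S l \<le> ereal (of_int (a l)) + ereal (of_nat (s - l))"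
    unfolding trop_term_def by (intro add_left_mono) simp
  also have "\<dots> = ereal (of_int (a l + int s - int l))"
    using s by (simp add: of_nat_diff)
  finally show ?thesis .
qed

text \<open>The infimum defining \<open>val\<close> is attained unless \<open>S\<close> has no element from \<open>l\<close> on.\<close>

lemma trop_term_cases:
  obtains (infinite) "\<And>s. s \<in> S \<Longrightarrow> s < l" "trop_term a S l = \<infinity>"
  | (finite) s where "s \<in> S" "l \<le> s" "trop_term a S l = ereal (of_int (a l + int s - int l))"
proof (cases "{s \<in> S. l \<le> s} = {}")
  case True
  then have "val S l = \<infinity>"
    unfolding val_def by (simp only: image_empty Inf_enat_def) simp
  with True infinite show thesis unfolding trop_term_def by (auto simp: not_le)
next
  case False
  then obtain r where "enat (r - l) \<in> (\<lambda>s. enat (s - l)) ` {s \<in> S. l \<le> s}" by blast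
  then have "val S l \<in> (\<lambda>s. enat (s - l)) ` {s \<in> S. l \<le> s}"
    unfolding val_def by (rule wellorder_InfI)
  then obtain s where s: "s \<in> S" "l \<le> s" "val S l = enat (s - l)" by auto
  then have "trop_term a S l = ereal (of_int (a l + int s - int l))"
    unfolding trop_term_def by (simp add: of_nat_diff)
  with s finite show thesis by blast
qed

text \<open>
  The term of index \<open>i\<close> at the point \<open>s\<close> and the term of index \<open>j\<close> at the point \<open>t\<close> tie for
  the minimum over all indices \<open>l \<le> k\<close> and all points \<open>r \<in> S\<close> with \<open>l \<le> r\<close>. Integers are used so that \<open>s - i\<close> needs
  no truncation.
\<close>

definition balanced_at ::
  "nat \<Rightarrow> (nat \<Rightarrow> int) \<Rightarrow> nat set \<Rightarrow> nat \<Rightarrow> nat \<Rightarrow> nat \<Rightarrow> nat \<Rightarrow> bool" where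
  "balanced_at k a S i s j t \<longleftrightarrow>
    i \<le> k \<and> j \<le> k \<and> i \<noteq> j \<and> s \<in> S \<and> t \<in> S \<and> i \<le> s \<and> j \<le> t \<and>
    a i + int s - int i = a j + int t - int j \<and>
    (\<forall>l\<le>k. \<forall>r\<in>S. l \<le> r \<longrightarrow> a i + int s - int i \<le> a l + int r - int l)"

lemma balanced_at_sym: "balanced_at k a S i s j t \<Longrightarrow> balanced_at k a S j t i s"
  unfolding balanced_at_def by auto

lemma balanced_at_subset:
  "balanced_at k a S i s j t \<Longrightarrow> s \<in> T \<Longrightarrow> t \<in> T \<Longrightarrow> T \<subseteq> S \<Longrightarrow> balanced_at k a T i s j t"
  unfolding balanced_at_def by blast

lemma Sol_iff_balanced:
  assumes "S \<noteq> {}"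
  shows "S \<in> Sol k a \<longleftrightarrow> (\<exists>i s j t. balanced_at k a S i s j t)"
proof -
  \<comment> \<open>Index 0 always has a finite term, so the minimum is finite.\<close>
  obtain s0 where "s0 \<in> S" using assms by blast
  then have fin0: "trop_term a S 0 \<noteq> \<infinity>"
    using trop_term_le[of s0 S 0 a] by auto
  have "Min (trop_term a S ` {0..k}) \<le> trop_term a S 0"
    by (intro Min_le) auto
  with fin0 have "Min (trop_term a S ` {0..k}) \<noteq> \<infinity>"
    by (metis ereal_infty_less_eq(1))
  then have "S \<in> Sol k a \<longleftrightarrow> min_attained_twice k (trop_term a S)"
    unfolding Sol_def by simp
  also have "\<dots> \<longleftrightarrow> (\<exists>i s j t. balanced_at k a S i s j t)"
  proof
    assume "min_attained_twice k (trop_term a S)"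
    then obtain i j where ij: "i \<le> k" "j \<le> k" "i \<noteq> j" "trop_term a S i = trop_term a S j"
      and least: "\<And>l. l \<le> k \<Longrightarrow> trop_term a S i \<le> trop_term a S l"
      unfolding min_attained_twice_iff by blast
    have fin: "trop_term a S i \<noteq> \<infinity>" "trop_term a S j \<noteq> \<infinity>"
      using least[of 0] fin0 ij(4) by auto
    obtain s where s: "s \<in> S" "i \<le> s" "trop_term a S i = ereal (of_int (a i + int s - int i))"
      using fin(1) by (cases rule: trop_term_cases[of S i a]) auto
    obtain t where t: "t \<in> S" "j \<le> t" "trop_term a S j = ereal (of_int (a j + int t - int j))"
      using fin(2) by (cases rule: trop_term_cases[of S j a]) auto
    have eq: "a i + int s - int i = a j + int t - int j"
      using ij(4) unfolding s(3) t(3) ereal.inject of_int_eq_iff .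
    have "a i + int s - int i \<le> a l + int r - int l" if "l \<le> k" "r \<in> S" "l \<le> r" for l r
      using order_trans[OF least[OF that(1)] trop_term_le[OF that(2,3)]]
      unfolding s(3) ereal_less_eq of_int_le_iff .
    with ij s t eq show "\<exists>i s j t. balanced_at k a S i s j t"
      unfolding balanced_at_def by blast
  next
    assume "\<exists>i s j t. balanced_at k a S i s j t"
    then obtain i s j t where b: "balanced_at k a S i s j t" by blast
    have eq_term: "trop_term a S i = ereal (of_int (a i + int s - int i))"
      and lower: "\<forall>l\<le>k. trop_term a S i \<le> trop_term a S l"
      if b: "balanced_at k a S i s j t" for i s j t
    proof -
      have ge: "ereal (of_int (a i + int s - int i)) \<le> trop_term a S l" if "l \<le> k" for l
      proof (cases rule: trop_term_cases[of S l a])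
        case infinite
        then show ?thesis by simp
      next
        case (finite r)
        with b that show ?thesis
          unfolding finite(3) ereal_less_eq of_int_le_iff balanced_at_def by blast
      qed
      have "trop_term a S i \<le> ereal (of_int (a i + int s - int i))"
        using b unfolding balanced_at_def by (intro trop_term_le) auto
      moreover have "i \<le> k" using b unfolding balanced_at_def by blast
      ultimately show eq: "trop_term a S i = ereal (of_int (a i + int s - int i))"
        using ge by (intro antisym) auto
      show "\<forall>l\<le>k. trop_term a S i \<le> trop_term a S l"
        unfolding eq using ge by blast
    qed
    have "trop_term a S i = trop_term a S j"
      using b unfolding eq_term[OF b] eq_term[OF balanced_at_sym[OF b]] balanced_at_def by simp
    with lower[OF b] b show "min_attained_twice k (trop_term a S)"
      unfolding min_attained_twice_iff balanced_at_def by blast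
  qed
  finally show ?thesis .
qed

lemma Sol_if_contains_witnesses:
  assumes "balanced_at k a S i s j t" "s \<in> T" "t \<in> T" "T \<subseteq> S"
  shows "T \<in> Sol k a"
proof -
  have "T \<noteq> {}" using assms(2) by blast
  moreover have "balanced_at k a T i s j t" using assms by (rule balanced_at_subset)
  ultimately show ?thesis by (subst Sol_iff_balanced) blast+
qed

section \<open>Minimal solutions\<close>

lemma minimal_nonemptyD:
  assumes "S \<in> minimal_nonempty X" "T \<in> X" "T \<noteq> {}" "T \<subseteq> S"
  shows "T = S"
  using assms unfolding minimal_nonempty_def by simp

lemma minimal_solution_balanced:
  assumes "S \<in> minimal_nonempty (Sol k a)"
  obtains i s j t where "balanced_at k a S i s j t"
proof -
  have "S \<noteq> {}" "S \<in> Sol k a" using assms unfolding minimal_nonempty_def by blast+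
  with Sol_iff_balanced that show thesis by metis
qed

lemma minimal_solution_eq_pair:
  assumes "S \<in> minimal_nonempty (Sol k a)" "balanced_at k a S i s j t"
  shows "S = {s, t}"
proof -
  have sub: "{s, t} \<subseteq> S" using assms(2) unfolding balanced_at_def by blast
  have "{s, t} \<in> Sol k a" by (rule Sol_if_contains_witnesses[OF assms(2) _ _ sub]) auto
  then have "{s, t} = S" using assms(1) sub by (intro minimal_nonemptyD) auto
  then show ?thesis by simp
qed

lemma minimal_solution_singleton_iff:
  "{s} \<in> minimal_nonempty (Sol k a) \<longleftrightarrow> {s} \<in> Sol k a"
  unfolding minimal_nonempty_def by (auto simp: subset_singleton_iff)

lemma le_Inf_nat_iff:
  fixes S :: "nat set"
  assumes "S \<noteq> {}"
  shows "k \<le> Inf S \<longleftrightarrow> (\<forall>s\<in>S. k \<le> s)"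
proof
  assume "k \<le> Inf S"
  then show "\<forall>s\<in>S. k \<le> s" using wellorder_Inf_le1[of _ S] order_trans by blast
next
  assume "\<forall>s\<in>S. k \<le> s"
  then show "k \<le> Inf S" using assms by (intro cInf_greatest) auto
qed

lemma C_nonneg_iff:
  "S \<in> C_nonneg k a \<longleftrightarrow> S \<in> minimal_nonempty (Sol k a) \<and> (\<forall>s\<in>S. k \<le> s)"
  unfolding C_nonneg_def using le_Inf_nat_iff[of S k] by (auto simp: minimal_nonempty_def)

lemma F_iff:
  "S \<in> F k a \<longleftrightarrow> S \<in> minimal_nonempty (Sol k a) \<and> (\<exists>s\<in>S. s < k)"
  unfolding F_def using C_nonneg_iff[of S k a] by (auto simp: not_le)

section \<open>Minimal solutions above the order\<close>

lemma singleton_solution_iff_in_V_A: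
  assumes "k \<le> s"
  shows "{s} \<in> Sol k a \<longleftrightarrow> in_V_A k a"
proof -
  have "{s} \<in> Sol k a \<longleftrightarrow> (\<exists>i j. balanced_at k a {s} i s j s)"
  proof -
    have "s' = s \<and> t = s" if "balanced_at k a {s} i s' j t" for i s' j t
      using that unfolding balanced_at_def by blast
    moreover have "{s} \<in> Sol k a \<longleftrightarrow> (\<exists>i s' j t. balanced_at k a {s} i s' j t)"
      by (rule Sol_iff_balanced) simp
    ultimately show ?thesis by metis
  qed
  also have "\<dots> \<longleftrightarrow> in_V_A k a"
  proof -
    have "a l + int s - int l = (a l + int (k - l)) + (int s - int k)" if "l \<le> k" for l
      using that by (simp add: of_nat_diff)
    then have "balanced_at k a {s} i s j s \<longleftrightarrow>
        i \<le> k \<and> j \<le> k \<and> i \<noteq> j \<and>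
        a i + int (k - i) = a j + int (k - j) \<and> (\<forall>l\<le>k. a i + int (k - i) \<le> a l + int (k - l))"
      for i j
      using assms unfolding balanced_at_def by (auto cong: conj_cong)
    then show ?thesis unfolding in_V_A_def min_attained_twice_iff by blast
  qed
  finally show ?thesis .
qed

lemma minimal_solution_above:
  assumes S: "S \<in> minimal_nonempty (Sol k a)" and ge: "\<forall>s\<in>S. k \<le> s"
  obtains s where "S = {s}"
proof -
  from S obtain i s j t where b: "balanced_at k a S i s j t"
    by (rule minimal_solution_balanced)
  have "i \<le> t" "j \<le> s" using b ge unfolding balanced_at_def by (meson order_trans)+
  \<comment> \<open>Both indices may be evaluated at both points, so neither point can be the larger one.\<close>
  then have "a i + int s - int i \<le> a i + int t - int i"
    "a j + int t - int j \<le> a j + int s - int j"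
    using b balanced_at_sym[OF b] unfolding balanced_at_def by blast+
  then have "s = t" by simp
  with minimal_solution_eq_pair[OF S b] that show thesis by simp
qed

lemma C_nonneg_eq: "C_nonneg k a = (if in_V_A k a then {{k + i} | i :: nat. True} else {})"
proof -
  have "S \<in> C_nonneg k a \<longleftrightarrow> in_V_A k a \<and> (\<exists>i. S = {k + i})" for S
  proof
    assume "S \<in> C_nonneg k a"
    then have S: "S \<in> minimal_nonempty (Sol k a)" "\<forall>s\<in>S. k \<le> s"
      unfolding C_nonneg_iff by auto
    then obtain s where "S = {s}" by (rule minimal_solution_above)
    with S singleton_solution_iff_in_V_A[of k s a] show "in_V_A k a \<and> (\<exists>i. S = {k + i})"
      by (auto simp: minimal_solution_singleton_iff le_iff_add)
  next
    assume "in_V_A k a \<and> (\<exists>i. S = {k + i})"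
    then show "S \<in> C_nonneg k a"
      using singleton_solution_iff_in_V_A[of k _ a]
      by (auto simp: C_nonneg_iff minimal_solution_singleton_iff)
  qed
  then show ?thesis by auto
qed

section \<open>Minimal solutions with an element below the order\<close>

text \<open>The two points of a minimal solution with two elements are both needed as witnesses.\<close>

lemma minimal_pair_balanced:
  assumes S: "{p, q} \<in> minimal_nonempty (Sol k a)" and "p \<noteq> q"
  obtains i j where "balanced_at k a {p, q} i p j q"
proof -
  from S obtain i s j t where b: "balanced_at k a {p, q} i s j t"
    by (rule minimal_solution_balanced)
  from minimal_solution_eq_pair[OF S b] have "s = p \<and> t = q \<or> s = q \<and> t = p"
    by (auto simp: doubleton_eq_iff)
  with b balanced_at_sym[OF b] that show thesis by blast
qed

text \<open>
  The two pairs share the tying value, namely the minimum of \<open>a l + (p - l)\<close> over \<open>l \<le> p\<close>. As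
  \<open>q' \<ge> k\<close>, the index that attains it at \<open>q\<close> may also be evaluated at \<open>q'\<close>, where its term cannot
  be smaller than the shared value.
\<close>

lemma minimal_pair_upper_le:
  assumes q: "{p, q} \<in> minimal_nonempty (Sol k a)" "p < k" "k \<le> q"
    and q': "{p, q'} \<in> minimal_nonempty (Sol k a)" "k \<le> q'"
  shows "q \<le> q'"
proof -
  obtain i j where b: "balanced_at k a {p, q} i p j q"
    using q by (auto intro: minimal_pair_balanced)
  obtain i' j' where b': "balanced_at k a {p, q'} i' p j' q'"
    using q(2) q' by (auto intro: minimal_pair_balanced)
  have "a i + int p - int i = a i' + int p - int i'"
    using b b' unfolding balanced_at_def by (intro antisym) auto
  moreover have "a i' + int p - int i' \<le> a j + int q' - int j"
    using b b' q'(2) unfolding balanced_at_def by auto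
  moreover have "a i + int p - int i = a j + int q - int j"
    using b unfolding balanced_at_def by blast
  ultimately show ?thesis by linarith
qed

lemma F_pair_upper_unique:
  assumes "p < k" "k \<le> q" "{p, q} \<in> F k a" "k \<le> q'" "{p, q'} \<in> F k a"
  shows "q = q'"
proof -
  have m: "{p, q} \<in> minimal_nonempty (Sol k a)" "{p, q'} \<in> minimal_nonempty (Sol k a)"
    using assms(3,5) by (simp_all add: F_iff)
  show ?thesis
    using minimal_pair_upper_le[OF m(1) assms(1,2) m(2) assms(4)]
      minimal_pair_upper_le[OF m(2) assms(1,4) m(1) assms(2)] by (rule antisym)
qed

lemma F_pair:
  assumes "S \<in> F k a"
  shows "\<exists>p q. S = {p, q} \<and> p \<le> q \<and> (q < k \<or> p < k \<and> k \<le> q)"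
proof -
  from assms have S: "S \<in> minimal_nonempty (Sol k a)" and low: "\<exists>r\<in>S. r < k"
    unfolding F_iff by auto
  from S obtain i s j t where "balanced_at k a S i s j t"
    by (rule minimal_solution_balanced)
  with S have "S = {s, t}" by (rule minimal_solution_eq_pair)
  then have "S = {min s t, max s t}" by (auto simp: min_def max_def)
  with low show ?thesis
    by (intro exI[of _ "min s t"] exI[of _ "max s t"]) auto
qed

lemma finite_F: "finite (F k a)"
proof -
  define upper where "upper p = (THE q. k \<le> q \<and> {p, q} \<in> F k a)" for p
  have "F k a \<subseteq> (\<lambda>(p, q). {p, q}) ` ({..<k} \<times> {..<k}) \<union> (\<lambda>p. {p, upper p}) ` {..<k}"
  proof
    fix S assume S: "S \<in> F k a"
    then obtain p q where pq: "S = {p, q}" "p \<le> q" "q < k \<or> p < k \<and> k \<le> q"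
      using F_pair by blast
    show "S \<in> (\<lambda>(p, q). {p, q}) ` ({..<k} \<times> {..<k}) \<union> (\<lambda>p. {p, upper p}) ` {..<k}"
    proof (cases "q < k")
      case True
      with pq show ?thesis by auto
    next
      case False
      with pq have "p < k" "k \<le> q" by auto
      then have "upper p = q"
        unfolding upper_def using S pq(1) F_pair_upper_unique
        by (intro the_equality) auto
      with pq \<open>p < k\<close> show ?thesis by auto
    qed
  qed
  then show ?thesis by (rule finite_subset) auto
qed

lemma F_mixed_pair_not_in_V_A:
  assumes "p < k" "k \<le> q" "{p, q} \<in> F k a"
  shows "\<not> in_V_A k a"
proof
  assume "in_V_A k a"
  then have "{q} \<in> Sol k a" using assms(2) by (simp add: singleton_solution_iff_in_V_A)
  moreover have "{p, q} \<in> minimal_nonempty (Sol k a)"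
    using assms(3) by (simp add: F_iff)
  ultimately have "{q} = {p, q}" by (intro minimal_nonemptyD) auto
  with assms(1,2) show False by auto
qed

lemma holonomic_iff_not_in_V_A: "holonomic k a \<longleftrightarrow> \<not> in_V_A k a"
proof -
  have "minimal_nonempty (Sol k a) = C_nonneg k a \<union> F k a"
    unfolding F_def C_nonneg_def by auto
  then have "holonomic k a \<longleftrightarrow> finite (C_nonneg k a)"
    unfolding holonomic_def by (simp add: finite_F)
  moreover have "infinite {{k + i} | i :: nat. True}"
  proof -
    have "inj (\<lambda>i::nat. {k + i})" by (auto intro: injI)
    then have "infinite (range (\<lambda>i::nat. {k + i}))" by (rule range_inj_infinite)
    then show ?thesis by (simp add: full_SetCompr_eq)
  qed
  ultimately show ?thesis unfolding C_nonneg_eq by simp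
qed

theorem theorem3p8:
  fixes k :: nat and a :: "nat \<Rightarrow> int"
  assumes "1 \<le> k"
  shows "C_nonneg k a = (if in_V_A k a then {{k + i} | i :: nat. True} else {}) \<and>
    (holonomic k a \<longleftrightarrow> \<not> in_V_A k a) \<and>
    finite (F k a) \<and>
    (\<forall>S\<in>F k a. \<exists>p q. S = {p, q} \<and> p \<le> q \<and> (q < k \<or> p < k \<and> k \<le> q)) \<and>
    (\<forall>p<k. \<exists>\<^sub>\<le>\<^sub>1 q. k \<le> q \<and> {p, q} \<in> F k a) \<and>
    (\<forall>p q. p < k \<and> k \<le> q \<and> {p, q} \<in> F k a \<longrightarrow> \<not> in_V_A k a)"
proof (intro conjI)
  show "\<forall>p<k. \<exists>\<^sub>\<le>\<^sub>1 q. k \<le> q \<and> {p, q} \<in> F k a"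
    unfolding Uniq_def using F_pair_upper_unique by blast
  show "\<forall>S\<in>F k a. \<exists>p q. S = {p, q} \<and> p \<le> q \<and> (q < k \<or> p < k \<and> k \<le> q)"
    using F_pair by blast
  show "\<forall>p q. p < k \<and> k \<le> q \<and> {p, q} \<in> F k a \<longrightarrow> \<not> in_V_A k a"
    using F_mixed_pair_not_in_V_A by blast
qed (rule C_nonneg_eq holonomic_iff_not_in_V_A finite_F)+

end
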